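(* Let $I$ be one of the intervals $(a,b)$, $(a,b]$, $[a,b)$, $[a,b]$, $(-\infty,b)$, $(-\infty,b]$, $(a,\infty)$, $[a,\infty)$, $(-\infty,\infty)$, where $a<b$ are real numbers, and let $f:I\to I$ be a continuous transitive map. Consider the following two conditions. (A) There exist a fixed point $z$ of $f$ and a point $c\neq z$ in $I$ such that $\dfrac{f(c)-z}{c-z}\ge 1$. (B) $f$ has a unique fixed point $z$, this $z$ lies in the interior of $I$, and $\dfrac{f(x)-x}{z-x}>0$ for all $x\ne z$ in $I$ (i.e., both $f(x)$ and $z$ lie on the same side of $x$). Then exactly one of (A) and (B) holds, and: (1) if (A) holds, then $f$ is turbulent on $I$ (and so $f^2$ is doubly turbulent on $I$) and $f$ has periodic points of all periods (that is, for every $m\ge1$ there is a period-$m$ point of $f$); (2) if (B) holds, then $f^2$ is doubly turbulent on $I$ and $f$ has periodic points of all even periods. Consequently, if $f$ is a continuous transitive map on $I$, then $f$ has periodic points of all even periods and $f^2$ is doubly turbulent on $I$.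
   Context: All intervals are non-degenerate intervals in the real line. $f^n$ denotes the $n$-th iterate of $f$. A point $x_0\in I$ is a period-$m$ point of $f$ (has least period $m$) if $f^m(x_0)=x_0$ and $f^i(x_0)\neq x_0$ for $0<i<m$; "periodic points of all (even) periods" refers to least periods. $f$ is transitive on $I$ if for any two nonempty (relatively) open sets $U,V$ in $I$ there is a positive integer $k$ with $f^k(U)\cap V\neq\emptyset$. For a continuous map $g:I\to I$ and a compact interval $J\subset I$: if there are two compact intervals $J_0,J_1\subset J$ with at most one point in common such that $g(J_0)\cap g(J_1)\supset J_0\cup J_1$, then $g$ is said to be turbulent on $J$ and on $I$. If there are two compact intervals $I_0,I_1\subset I$ with at most one point in common such that $g$ is turbulent on $I_0$ and on $I_1$, then $g$ is doubly turbulent on $I$. *)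

theory Defs
  imports "HOL-Analysis.Analysis"
begin

(* A map g : I -> I is represented by a total function on the reals, restricted to I by
   the assumption g ` I \<subseteq> I wherever it matters. All intervals are non-degenerate. *)

definition compact_interval :: "real set \<Rightarrow> bool" where
  "compact_interval J \<longleftrightarrow> (\<exists>a b. a < b \<and> J = {a..b})"

definition nondegenerate_interval :: "real set \<Rightarrow> bool" where
  "nondegenerate_interval I \<longleftrightarrow>
     (\<exists>a b. a < b \<and>
        (I = {a<..<b} \<or> I = {a<..b} \<or> I = {a..<b} \<or> I = {a..b} \<or>
         I = {..<b} \<or> I = {..b} \<or> I = {a<..} \<or> I = {a..} \<or> I = UNIV))"

definition transitive_on :: "(real \<Rightarrow> real) \<Rightarrow> real set \<Rightarrow> bool" where
  "transitive_on f I \<longleftrightarrow>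
     (\<forall>U V. openin (top_of_set I) U \<and> U \<noteq> {} \<and> openin (top_of_set I) V \<and> V \<noteq> {} \<longrightarrow>
        (\<exists>k>0. (f ^^ k) ` U \<inter> V \<noteq> {}))"

definition period_point :: "(real \<Rightarrow> real) \<Rightarrow> real set \<Rightarrow> nat \<Rightarrow> real \<Rightarrow> bool" where
  "period_point f I m x \<longleftrightarrow>
     x \<in> I \<and> 0 < m \<and> (f ^^ m) x = x \<and> (\<forall>i. 0 < i \<and> i < m \<longrightarrow> (f ^^ i) x \<noteq> x)"

(* Turbulence on an arbitrary interval I means turbulence on some compact J \<subseteq> I.
   If I is itself compact, J = I is allowed, so the same definition also expresses
   turbulence on a given compact interval. *)
definition turbulent_on :: "(real \<Rightarrow> real) \<Rightarrow> real set \<Rightarrow> bool" where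
  "turbulent_on g I \<longleftrightarrow>
     (\<exists>J J0 J1. compact_interval J \<and> J \<subseteq> I \<and>
        compact_interval J0 \<and> compact_interval J1 \<and> J0 \<subseteq> J \<and> J1 \<subseteq> J \<and>
        (\<exists>p. J0 \<inter> J1 \<subseteq> {p}) \<and> J0 \<union> J1 \<subseteq> g ` J0 \<inter> g ` J1)"

definition doubly_turbulent_on :: "(real \<Rightarrow> real) \<Rightarrow> real set \<Rightarrow> bool" where
  "doubly_turbulent_on g I \<longleftrightarrow>
     (\<exists>I0 I1. compact_interval I0 \<and> compact_interval I1 \<and> I0 \<subseteq> I \<and> I1 \<subseteq> I \<and>
        (\<exists>p. I0 \<inter> I1 \<subseteq> {p}) \<and> turbulent_on g I0 \<and> turbulent_on g I1)"

definition condition_A :: "(real \<Rightarrow> real) \<Rightarrow> real set \<Rightarrow> bool" where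
  "condition_A f I \<longleftrightarrow>
     (\<exists>z\<in>I. f z = z \<and> (\<exists>c\<in>I. c \<noteq> z \<and> (f c - z) / (c - z) \<ge> 1))"

definition condition_B :: "(real \<Rightarrow> real) \<Rightarrow> real set \<Rightarrow> bool" where
  "condition_B f I \<longleftrightarrow>
     (\<exists>z. {x \<in> I. f x = x} = {z} \<and> z \<in> interior I \<and>
        (\<forall>x\<in>I. x \<noteq> z \<longrightarrow> (f x - x) / (z - x) > 0))"

end

theory Submission
  imports Defs
begin

text \<open>A transitive map has no invariant proper subinterval. If $f$ moves points to the right of a
  fixed point $p$ away from $p$ and comes back to $p$ or below further right, take the first point $d$
  with $f(d) = p$: since $[p,d]$ is not invariant, $f$ exceeds $d$ there, which is a horseshoe. Under
  (A) such a return exists, possibly after reflection, and the horseshoe gives turbulence and all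
  periods. Under (B) the same argument is applied to the map on $I \cap [z,\infty)$ that follows
  only those orbit pieces $x > z$, $f(x) < z$, $f^2(x) > z$ and collapses everything else to $z$: it
  inherits the absence of invariant subintervals from $f$. The resulting horseshoe of $f^2$ lies to the
  right of $z$, whereas odd iterates pass through the left of $z$; this yields a second horseshoe of
  $f^2$ there, and loops whose least period is any prescribed even number.\<close>

section \<open>First and last meeting points of continuous functions\<close>

lemma first_zero:
  fixes h :: "real \<Rightarrow> real"
  assumes cont: "continuous_on {l..r} h" and "l \<le> r" "h l > 0" "h r \<le> 0"
  obtains p where "l < p" "p \<le> r" "h p = 0" "\<And>x. l \<le> x \<Longrightarrow> x < p \<Longrightarrow> h x > 0"
proof -
  let ?S = "{x \<in> {l..r}. h x \<le> 0}"
  have "closed ?S"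
    using continuous_closed_preimage[OF cont closed_atLeastAtMost, of "{..0}"]
    by (simp add: vimage_def Int_def)
  moreover have "?S = {l..r} \<inter> ?S" by auto
  ultimately have "compact ?S" by (metis compact_Icc compact_Int_closed)
  moreover have "?S \<noteq> {}" using assms by force
  ultimately obtain p where p: "p \<in> ?S" "\<And>x. x \<in> ?S \<Longrightarrow> p \<le> x"
    using compact_attains_inf[of ?S] by blast
  have "h p = 0"
  proof (rule ccontr)
    assume "h p \<noteq> 0"
    with p(1) have "h p < 0" by auto
    moreover have "continuous_on {l..p} h" using p(1) by (auto intro: continuous_on_subset[OF cont])
    ultimately obtain x where "l \<le> x" "x \<le> p" "h x = 0"
      using IVT2'[of h p 0 l] p(1) assms by force
    with p \<open>h p < 0\<close> show False by force
  qed
  moreover have "l < p" using p(1) \<open>h p = 0\<close> assms by (cases "l = p") auto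
  moreover have "h x > 0" if "l \<le> x" "x < p" for x
    using p(2)[of x] p(1) that by force
  ultimately show ?thesis using that p(1) by force
qed

lemma last_zero:
  fixes h :: "real \<Rightarrow> real"
  assumes cont: "continuous_on {l..r} h" and "l \<le> r" "h r > 0" "h l \<le> 0"
  obtains p where "l \<le> p" "p < r" "h p = 0" "\<And>x. p < x \<Longrightarrow> x \<le> r \<Longrightarrow> h x > 0"
proof -
  have "continuous_on {-r..-l} (\<lambda>x. h (- x))"
    by (intro continuous_on_compose2[OF cont] continuous_intros) auto
  then obtain p where p: "- r < p" "p \<le> - l" "h (- p) = 0"
      "\<And>x. - r \<le> x \<Longrightarrow> x < p \<Longrightarrow> h (- x) > 0"
    using first_zero[of "-r" "-l" "\<lambda>x. h (- x)"] assms by auto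
  show ?thesis
  proof (rule that[of "- p"])
    fix x assume "- p < x" "x \<le> r"
    then show "h x > 0" using p(4)[of "- x"] by simp
  qed (use p in auto)
qed

text \<open>With one function constant this finds the first point on a given level, with one the
  identity the next fixed point.\<close>

lemma first_meeting:
  fixes f g :: "real \<Rightarrow> real"
  assumes "continuous_on {l..r} f" "continuous_on {l..r} g" "l \<le> r" "g l < f l" "f r \<le> g r"
  obtains p where "l < p" "p \<le> r" "f p = g p" "\<And>x. l \<le> x \<Longrightarrow> x < p \<Longrightarrow> g x < f x"
proof -
  have "continuous_on {l..r} (\<lambda>x. f x - g x)" by (intro continuous_intros assms)
  then show ?thesis
  proof (rule first_zero[OF _ assms(3)])
    fix p assume p: "l < p" "p \<le> r" "f p - g p = 0" "\<And>x. l \<le> x \<Longrightarrow> x < p \<Longrightarrow> 0 < f x - g x"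
    have "g x < f x" if "l \<le> x" "x < p" for x using p(4)[OF that] by simp
    with p(1-3) show thesis by (intro that[of p]) auto
  qed (use assms in simp_all)
qed

lemma last_meeting:
  fixes f g :: "real \<Rightarrow> real"
  assumes "continuous_on {l..r} f" "continuous_on {l..r} g" "l \<le> r" "f l \<le> g l" "g r < f r"
  obtains p where "l \<le> p" "p < r" "f p = g p" "\<And>x. p < x \<Longrightarrow> x \<le> r \<Longrightarrow> g x < f x"
proof -
  have "continuous_on {l..r} (\<lambda>x. f x - g x)" by (intro continuous_intros assms)
  then show ?thesis
  proof (rule last_zero[OF _ assms(3)])
    fix p assume p: "l \<le> p" "p < r" "f p - g p = 0" "\<And>x. p < x \<Longrightarrow> x \<le> r \<Longrightarrow> 0 < f x - g x"
    have "g x < f x" if "p < x" "x \<le> r" for x using p(4)[OF that] by simp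
    with p(1-3) show thesis by (intro that[of p]) auto
  qed (use assms in simp_all)
qed

lemma segment_cover:
  fixes f :: "real \<Rightarrow> real"
  assumes "continuous_on I f" "closed_segment a b \<subseteq> I"
  shows "closed_segment (f a) (f b) \<subseteq> f ` closed_segment a b"
  using IVT'_closed_segment_real[of _ f a b] continuous_on_subset[OF assms] by blast

subsection \<open>Loops of covering intervals\<close>

text \<open>The last point before \<open>t\<close> at level \<open>p\<close>, and after it the first
  point at level \<open>q\<close>, leave no room for values outside \<open>{p..q}\<close> in
  between.\<close>

lemma onto_subinterval_increasing:
  fixes g :: "real \<Rightarrow> real"
  assumes g: "continuous_on {x..y} g"
    and st: "x \<le> s" "s \<le> t" "t \<le> y" "g s = p" "g t = q" "p < q"
  shows "\<exists>x' y'. x \<le> x' \<and> x' \<le> y' \<and> y' \<le> y \<and> g ` {x'..y'} = {p..q}"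
proof -
  have cont: "continuous_on {l..t} g" if "s \<le> l" for l
    using st that by (intro continuous_on_subset[OF g]) auto
  have "g s \<le> p" "p < g t" using st by auto
  then obtain s' where s': "s \<le> s'" "s' < t" "g s' = p"
      "\<And>r. s' < r \<Longrightarrow> r \<le> t \<Longrightarrow> p < g r"
    using last_meeting[OF cont[of s] continuous_on_const[of _ p] st(2)] by blast
  have "g s' < q" "q \<le> g t" "s' \<le> t" using s' st by auto
  then obtain t' where t': "s' < t'" "t' \<le> t" "q = g t'"
      "\<And>r. s' \<le> r \<Longrightarrow> r < t' \<Longrightarrow> g r < q"
    using first_meeting[OF continuous_on_const[of _ q] cont[OF s'(1)]] by blast
  have "g ` {s'..t'} \<subseteq> {p..q}"
  proof clarsimp
    fix r assume "s' \<le> r" "r \<le> t'"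
    then show "p \<le> g r \<and> g r \<le> q"
      using s'(3) s'(4)[of r] t'(2,3) t'(4)[of r] \<open>p < q\<close> by (cases "r = s'"; cases "r = t'") auto
  qed
  moreover have "{p..q} \<subseteq> g ` {s'..t'}"
  proof -
    have "continuous_on {s'..t'} g"
      using st s' t' by (intro continuous_on_subset[OF g]) auto
    then have "\<exists>x\<ge>s'. x \<le> t' \<and> g x = w" if "p \<le> w" "w \<le> q" for w
      using IVT'[of g s' w t'] s'(3) t'(1,3) that by simp
    then show ?thesis by (metis atLeastAtMost_iff image_eqI subsetI)
  qed
  ultimately show ?thesis using st s' t' by (intro exI[of _ s'] exI[of _ t']) auto
qed

lemma onto_subinterval:
  fixes f :: "real \<Rightarrow> real"
  assumes cont: "continuous_on {x..y} f" and uv: "u \<le> v" "{u..v} \<subseteq> f ` {x..y}"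
  obtains x' y' where "x \<le> x'" "x' \<le> y'" "y' \<le> y" "f ` {x'..y'} = {u..v}"
proof -
  have "u \<in> {u..v}" "v \<in> {u..v}" using uv(1) by auto
  with uv(2) obtain s t where s: "s \<in> {x..y}" "f s = u" and t: "t \<in> {x..y}" "f t = v" by blast
  consider "u = v" | "u < v" "s \<le> t" | "u < v" "t \<le> s" using uv by linarith
  then show ?thesis
  proof cases
    case 1
    then show ?thesis using s by (intro that[of s s]) auto
  next
    case 2
    then show ?thesis using onto_subinterval_increasing[OF cont, of s t u v] s t that by auto
  next
    case 3
    \<comment> \<open>Here the larger value is attained first; negation restores the increasing
      order.\<close>
    have "continuous_on {x..y} (\<lambda>x. - f x)" by (intro continuous_intros cont)
    from onto_subinterval_increasing[OF this, of t s "-v" "-u"] 3 s t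
    obtain x' y' where "x \<le> x'" "x' \<le> y'" "y' \<le> y" "(\<lambda>x. - f x) ` {x'..y'} = {-v..-u}" by auto
    moreover from this(4) have "f ` {x'..y'} = uminus ` {-v..-u}"
      by (metis (no_types, lifting) image_cong image_image minus_minus)
    ultimately show ?thesis using that by simp
  qed
qed

lemma segment_ivl:
  obtains l r where "l \<le> r" "closed_segment a (b::real) = {l..r}"
  by (cases "a \<le> b") (auto simp: closed_segment_eq_real_ivl)

lemma funpow_self_map:
  assumes "f ` I \<subseteq> I"
  shows "(f ^^ n) ` I \<subseteq> I"
proof (induction n)
  case (Suc n)
  then show ?case using assms by (auto simp: image_subset_iff)
qed simp

lemma continuous_on_funpow:
  fixes f :: "real \<Rightarrow> real"
  assumes "f ` I \<subseteq> I" "continuous_on I f"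
  shows "continuous_on I (f ^^ n)"
proof (induction n)
  case (Suc n)
  have "continuous_on ((f ^^ n) ` I) f"
    using funpow_self_map[OF assms(1)] assms(2) continuous_on_subset by blast
  with Suc show ?case using continuous_on_compose[of I "f ^^ n" f] by simp
qed (simp add: id_def)

text \<open>Pulling the segments back one at a time shrinks the starting interval until its points
  follow the itinerary. The last image is kept equal to its segment so that it covers the next one.
  Segments are unordered because \<open>f\<close> may swap the order of endpoints.\<close>

lemma covering_chain:
  fixes f :: "real \<Rightarrow> real"
  assumes f: "f ` I \<subseteq> I" "continuous_on I f"
    and sub: "\<And>i. closed_segment (p i) (q i) \<subseteq> I"
    and cov: "\<And>i. i < n \<Longrightarrow>
      closed_segment (p (Suc i)) (q (Suc i)) \<subseteq> f ` closed_segment (p i) (q i)"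
  shows "\<exists>x y. x \<le> y \<and> {x..y} \<subseteq> closed_segment (p 0) (q 0) \<and>
    (f ^^ n) ` {x..y} = closed_segment (p n) (q n) \<and>
    (\<forall>i\<le>n. (f ^^ i) ` {x..y} \<subseteq> closed_segment (p i) (q i))"
  using cov
proof (induction n)
  case 0
  obtain l r where "l \<le> r" "closed_segment (p 0) (q 0) = {l..r}" by (rule segment_ivl)
  then have "l \<le> r \<and> {l..r} \<subseteq> closed_segment (p 0) (q 0) \<and>
    (f ^^ 0) ` {l..r} = closed_segment (p 0) (q 0) \<and>
    (\<forall>i\<le>0. (f ^^ i) ` {l..r} \<subseteq> closed_segment (p i) (q i))" by simp
  then show ?case by blast
next
  case (Suc n)
  from Suc.IH[OF Suc.prems[OF less_SucI]] obtain x y where xy: "x \<le> y" "{x..y} \<subseteq> closed_segment (p 0) (q 0)"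
    "(f ^^ n) ` {x..y} = closed_segment (p n) (q n)"
    "\<forall>i\<le>n. (f ^^ i) ` {x..y} \<subseteq> closed_segment (p i) (q i)"
    by blast
  obtain l r where lr: "l \<le> r" "closed_segment (p (Suc n)) (q (Suc n)) = {l..r}"
    by (rule segment_ivl)
  have "(f ^^ Suc n) ` {x..y} = f ` closed_segment (p n) (q n)"
    using xy(3) by (metis funpow.simps(2) image_comp)
  then have cover: "{l..r} \<subseteq> (f ^^ Suc n) ` {x..y}" using Suc.prems[of n] lr by simp
  have "continuous_on {x..y} (f ^^ Suc n)"
    using continuous_on_funpow[OF f] xy(2) sub[of 0] continuous_on_subset by blast
  then obtain x' y' where xy': "x \<le> x'" "x' \<le> y'" "y' \<le> y" "(f ^^ Suc n) ` {x'..y'} = {l..r}"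
    using onto_subinterval[OF _ lr(1) cover] by blast
  have "(f ^^ i) ` {x'..y'} \<subseteq> closed_segment (p i) (q i)" if "i \<le> Suc n" for i
  proof (cases "i = Suc n")
    case False
    then have "(f ^^ i) ` {x..y} \<subseteq> closed_segment (p i) (q i)" using that xy(4) by simp
    moreover have "{x'..y'} \<subseteq> {x..y}" using xy' by auto
    ultimately show ?thesis by (meson dual_order.trans image_mono)
  qed (use xy' lr in simp)
  then show ?case using xy' lr xy(2)
    by (intro exI[of _ x'] exI[of _ y']) (auto simp del: funpow.simps)
qed

lemma covering_loop:
  fixes f :: "real \<Rightarrow> real"
  assumes f: "f ` I \<subseteq> I" "continuous_on I f"
    and sub: "\<And>i. closed_segment (p i) (q i) \<subseteq> I"
    and cov: "\<And>i. i < n \<Longrightarrow>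
      closed_segment (p (Suc i)) (q (Suc i)) \<subseteq> f ` closed_segment (p i) (q i)"
    and loop: "p n = p 0" "q n = q 0"
  obtains x where "(f ^^ n) x = x" "\<And>i. i \<le> n \<Longrightarrow> (f ^^ i) x \<in> closed_segment (p i) (q i)"
proof -
  obtain x y where xy: "x \<le> y" "{x..y} \<subseteq> closed_segment (p 0) (q 0)"
    "(f ^^ n) ` {x..y} = closed_segment (p 0) (q 0)"
    "\<And>i. i\<le>n \<Longrightarrow> (f ^^ i) ` {x..y} \<subseteq> closed_segment (p i) (q i)"
    using covering_chain[where p = p and q = q, OF f sub cov] loop by metis
  have cont: "continuous_on {x..y} (f ^^ n)"
    using continuous_on_funpow[OF f] xy(2) sub[of 0] continuous_on_subset by blast
  \<comment> \<open>The iterate maps \<open>{x..y}\<close> onto a segment containing it, so some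
    \<open>s\<close> goes to the left end and some \<open>t\<close> to the right end; the
    displacement vanishes between them.\<close>
  have "x \<in> (f ^^ n) ` {x..y}" "y \<in> (f ^^ n) ` {x..y}" using xy by auto
  then obtain s t where s: "s \<in> {x..y}" "(f ^^ n) s = x" and t: "t \<in> {x..y}" "(f ^^ n) t = y" by auto
  have st: "closed_segment s t \<subseteq> {x..y}" using s t by (simp add: closed_segment_subset)
  have "continuous_on (closed_segment s t) (\<lambda>w. (f ^^ n) w - w)"
    by (intro continuous_intros continuous_on_subset[OF cont st])
  from IVT'_closed_segment_real[OF _ this, of 0] s t
  obtain w where "w \<in> closed_segment s t" "(f ^^ n) w = w"
    by (auto simp: closed_segment_eq_real_ivl)
  with xy(4) st that show ?thesis by blast
qed

subsection \<open>Maps without invariant subintervals\<close>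

text \<open>The interval \<open>{u<..<v}\<close> encodes that \<open>K\<close> has interior, the
  intervals \<open>{r<..<s}\<close> that it is dense in \<open>R\<close>. The search for horseshoes
  uses transitivity only in this form, which passes to the cut-off map.\<close>

definition irreducible_on :: "(real \<Rightarrow> real) \<Rightarrow> real set \<Rightarrow> bool" where
  "irreducible_on g R \<longleftrightarrow> is_interval R \<and> continuous_on R g \<and> g ` R \<subseteq> R \<and>
     (\<forall>K u v r s. is_interval K \<and> K \<subseteq> R \<and> g ` K \<subseteq> K \<and> u < v \<and> {u<..<v} \<subseteq> K \<and>
        r < s \<and> {r<..<s} \<subseteq> R \<longrightarrow> {r<..<s} \<inter> K \<noteq> {})"

lemma irreducible_on_escape:
  assumes "irreducible_on g R" "is_interval K" "K \<subseteq> R" "u \<in> K" "v \<in> K" "u < v"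
    "r \<in> R" "s \<in> R" "r < s" "\<And>x. r < x \<Longrightarrow> x < s \<Longrightarrow> x \<notin> K"
  obtains x where "x \<in> K" "g x \<notin> K"
proof -
  have "{u<..<v} \<subseteq> K" using assms(2,4,5) unfolding is_interval_1 by (meson greaterThanLessThan_iff less_imp_le subsetI)
  moreover have "{r<..<s} \<subseteq> R" using assms(1,7,8) unfolding irreducible_on_def is_interval_1
    by (meson greaterThanLessThan_iff less_imp_le subsetI)
  moreover have "{r<..<s} \<inter> K = {}" using assms by auto
  ultimately have "\<not> g ` K \<subseteq> K" using assms unfolding irreducible_on_def by blast
  then show ?thesis using that by auto
qed

text \<open>Conjugation by negation turns each result about the right side of a point into one about
  its left side.\<close>

lemma irreducible_on_reflect:
  assumes "irreducible_on g R"
  shows "irreducible_on (\<lambda>x. - g (- x)) (uminus ` R)"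
  unfolding irreducible_on_def
proof (intro conjI allI impI)
  show "is_interval (uminus ` R)" using assms by (simp add: irreducible_on_def)
  show "continuous_on (uminus ` R) (\<lambda>x. - g (- x))"
  proof -
    have "continuous_on (uminus ` R) (g \<circ> uminus)"
      using assms unfolding irreducible_on_def
      by (intro continuous_on_compose continuous_intros) (simp add: image_image)
    then show ?thesis by (intro continuous_intros) (simp add: o_def)
  qed
  show "(\<lambda>x. - g (- x)) ` uminus ` R \<subseteq> uminus ` R"
    using assms unfolding irreducible_on_def by auto
next
  fix K u v r s
  assume "is_interval K \<and> K \<subseteq> uminus ` R \<and> (\<lambda>x. - g (- x)) ` K \<subseteq> K \<and> u < v \<and> {u<..<v} \<subseteq> K \<and>
    r < s \<and> {r<..<s} \<subseteq> uminus ` R"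
  then have K: "is_interval K" "K \<subseteq> uminus ` R" "(\<lambda>x. - g (- x)) ` K \<subseteq> K" "u < v" "{u<..<v} \<subseteq> K"
    "r < s" "{r<..<s} \<subseteq> uminus ` R" by auto
  let ?K = "uminus ` K"
  have mem: "x \<in> ?K \<longleftrightarrow> - x \<in> K" for x by force
  have "g ` ?K \<subseteq> ?K" using K(3) by (auto simp: mem)
  moreover have "?K \<subseteq> R" using K(2) by auto
  moreover have "{-v<..<-u} \<subseteq> ?K" using image_mono[OF K(5), of uminus] by simp
  moreover have "{-s<..<-r} \<subseteq> R" using image_mono[OF K(7), of uminus] by (simp add: image_image)
  moreover have "is_interval ?K" using K by simp
  ultimately have "{-s<..<-r} \<inter> ?K \<noteq> {}"
    using assms K(4,6) unfolding irreducible_on_def by (meson neg_less_iff_less)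
  then obtain w where "w \<in> K" "- s < - w" "- w < - r" by auto
  then show "{r<..<s} \<inter> K \<noteq> {}" by auto
qed

subsection \<open>Horseshoes\<close>

text \<open>For continuous \<open>g\<close>, the halves from \<open>a\<close> to \<open>b\<close>
  and from \<open>b\<close> to \<open>d\<close> are both mapped over the whole segment. The order of
  \<open>a\<close> and \<open>d\<close> is left open so that reflected horseshoes count too.\<close>

definition horseshoe :: "(real \<Rightarrow> real) \<Rightarrow> real set \<Rightarrow> real \<Rightarrow> real \<Rightarrow> real \<Rightarrow> bool" where
  "horseshoe g R a b d \<longleftrightarrow> a \<in> R \<and> d \<in> R \<and> b \<in> open_segment a d \<and> g a = a \<and> g b = d \<and> g d = a"

lemma horseshoe_reflect:
  assumes "\<exists>a b d. horseshoe (\<lambda>x. - g (- x)) (uminus ` R) a b d"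
  shows "\<exists>a b d. horseshoe g R a b d"
proof -
  obtain a b d where "horseshoe (\<lambda>x. - g (- x)) (uminus ` R) a b d" using assms by blast
  then have "horseshoe g R (- a) (- b) (- d)"
    unfolding horseshoe_def by (auto simp: open_segment_eq_real_ivl split: if_splits)
  then show ?thesis by blast
qed

lemma horseshoe_return:
  assumes irr: "irreducible_on g R" and "p \<in> R" "g p = p" "p < q"
    and above: "\<And>x. p < x \<Longrightarrow> x \<le> q \<Longrightarrow> g x > p"
    and y: "y \<in> R" "p < y" "g y \<le> p"
  shows "\<exists>a b d. horseshoe g R a b d"
proof -
  have "q < y" using above[of y] y by force
  have sub: "{p..y} \<subseteq> R" using irr assms(2) y(1) unfolding irreducible_on_def
    by (meson interval_subset_is_interval atLeastAtMost_iff is_interval_1 subsetI)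
  have cont: "continuous_on S g" if "S \<subseteq> {p..y}" for S
    using irr sub that unfolding irreducible_on_def by (meson continuous_on_subset)
  have "continuous_on {q..y} g" using \<open>p < q\<close> by (intro cont) auto
  moreover have "p < g q" "q \<le> y" using above \<open>p < q\<close> \<open>q < y\<close> by simp_all
  ultimately obtain d where d: "q < d" "d \<le> y" "g d = p" "\<And>x. q \<le> x \<Longrightarrow> x < d \<Longrightarrow> g x > p"
    using first_meeting[of q y g "\<lambda>_. p", OF _ continuous_on_const _ _ y(3)] by blast
  have "{p..d} \<subseteq> R" using sub d by auto
  obtain t where t: "t \<in> {p..d}" "\<And>x. x \<in> {p..d} \<Longrightarrow> g x \<le> g t"
    using continuous_attains_sup[of "{p..d}" g] cont[of "{p..d}"] d \<open>p < q\<close> by auto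
  \<comment> \<open>If the maximum \<open>g t\<close> were below \<open>d\<close>, then
    \<open>{p..g t}\<close> would be invariant and miss the gap up to \<open>d\<close>. This smaller
    interval leaves a gap even when \<open>{p..d}\<close> fills \<open>R\<close>.\<close>
  have "d \<le> g t"
  proof (rule ccontr)
    assume "\<not> d \<le> g t"
    moreover have "p < g t" using t(2)[of q] d(1) \<open>p < q\<close> above[of q] by fastforce
    moreover have "{p..g t} \<subseteq> R" using \<open>{p..d} \<subseteq> R\<close> \<open>\<not> d \<le> g t\<close> by auto
    ultimately obtain x where x: "x \<in> {p..g t}" "g x \<notin> {p..g t}"
      using irreducible_on_escape[OF irr, of "{p..g t}" p "g t" "g t" d] \<open>{p..d} \<subseteq> R\<close> d \<open>p < q\<close>
      by (auto simp: subset_eq)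
    then have "g x \<le> g t" using t(2)[of x] \<open>\<not> d \<le> g t\<close> by auto
    moreover have "p \<le> g x"
      using x(1) \<open>\<not> d \<le> g t\<close> above[of x] d(4)[of x] \<open>g p = p\<close> by (cases "x = p"; cases "x \<le> q") auto
    ultimately show False using x by auto
  qed
  moreover have "continuous_on {p..t} g" using t d by (intro cont) auto
  ultimately obtain b where "p \<le> b" "b \<le> t" "g b = d"
    using IVT'[of g p d t] t(1) d \<open>g p = p\<close> \<open>p < q\<close> by auto
  moreover have "b \<noteq> p" "b \<noteq> d" using calculation(3) \<open>g p = p\<close> d \<open>p < q\<close> by auto
  ultimately have "horseshoe g R p b d"
    unfolding horseshoe_def using \<open>{p..d} \<subseteq> R\<close> d t(1) \<open>g p = p\<close> \<open>p < q\<close> \<open>p \<in> R\<close>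
    by (auto simp: open_segment_eq_real_ivl)
  then show ?thesis by blast
qed

lemma horseshoe_return_left:
  assumes irr: "irreducible_on g R" and "p \<in> R" "g p = p" "q < p"
    and below: "\<And>x. q \<le> x \<Longrightarrow> x < p \<Longrightarrow> g x < p"
    and y: "y \<in> R" "y < p" "g y \<ge> p"
  shows "\<exists>a b d. horseshoe g R a b d"
proof (rule horseshoe_reflect, rule horseshoe_return[OF irreducible_on_reflect[OF irr], of "- p" "- q" "- y"])
  fix x assume "- p < x" "x \<le> - q"
  then show "- p < - g (- x)" using below[of "- x"] by simp
qed (use assms(2-4) y in simp_all)

text \<open>If \<open>g\<close> comes back to \<open>p\<close> or below,
  \<open>horseshoe_return\<close> applies. Otherwise points right of \<open>p\<close> stay there,
  and irreducibility lifts some of them above any level \<open>M\<close> while bringing another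
  below \<open>q\<close>. Between such a descent and a later ascent lies a fixed point
  \<open>d\<close>, with a horseshoe on its left.\<close>

lemma horseshoe_repelling:
  assumes irr: "irreducible_on g R" and pq: "p \<in> R" "q \<in> R" "g p = p" "p < q"
    and up: "\<And>x. p < x \<Longrightarrow> x \<le> q \<Longrightarrow> g x > x"
  shows "\<exists>a b d. horseshoe g R a b d"
proof (cases "\<exists>y\<in>R. p < y \<and> g y \<le> p")
  case True
  then obtain y where "y \<in> R" "p < y" "g y \<le> p" by auto
  moreover have "g x > p" if "p < x" "x \<le> q" for x using up[OF that] that by auto
  ultimately show ?thesis using horseshoe_return[OF irr pq(1,3,4)] by metis
next
  case False
  have sub: "{x..y} \<subseteq> R" if "x \<in> R" "y \<in> R" for x y
    using irr that unfolding irreducible_on_def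
    by (meson atLeastAtMost_iff is_interval_1 subsetI)
  have cont: "continuous_on S g" if "S \<subseteq> R" for S
    using irr that unfolding irreducible_on_def by (meson continuous_on_subset)
  have gR: "g x \<in> R" if "x \<in> R" for x using irr that unfolding irreducible_on_def by blast
  text \<open>As \<^term>\<open>g\<close> stays away from \<^term>\<open>p\<close> on \<^term>\<open>{q..M}\<close>, an interval \<^term>\<open>{e..M}\<close>
    with \<^term>\<open>e\<close> close to \<^term>\<open>p\<close> can only be left through its right end.\<close>
  have escape: "\<exists>x. p < x \<and> x \<le> M \<and> g x > M" if M: "M \<in> R" "q \<le> M" for M
  proof -
    have qM: "{q..M} \<subseteq> R" using sub M pq by blast
    obtain t where t: "t \<in> {q..M}" "\<And>x. x \<in> {q..M} \<Longrightarrow> g t \<le> g x"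
      using continuous_attains_inf[of "{q..M}" g] cont[OF qM] M by auto
    have "p < g t" using False t(1) qM pq(4) by force
    define e where "e = (p + min q (g t)) / 2"
    have e: "p < e" "e < q" "e < g t" using \<open>p < g t\<close> pq(4) unfolding e_def by auto
    have "{p..M} \<subseteq> R" using sub M pq by blast
    then obtain x where x: "x \<in> {e..M}" "g x \<notin> {e..M}"
      using irreducible_on_escape[OF irr, of "{e..M}" e M p e] e M pq by (auto simp: subset_eq)
    moreover have "e \<le> g x"
      using x(1) up[of x] t(2)[of x] e by (cases "x \<le> q") auto
    ultimately show ?thesis using e by (intro exI[of _ x]) auto
  qed
  \<comment> \<open>The part of \<open>R\<close> from \<open>q\<close> on misses the gap between
    \<open>p\<close> and \<open>q\<close>, so some point leaves it downward.\<close>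
  obtain y where y: "y \<in> R" "q \<le> y" "g y < q"
  proof -
    have "is_interval (R \<inter> {q..})" using irr unfolding irreducible_on_def is_interval_1
      by (metis Int_iff atLeast_iff order_trans)
    moreover have "g q \<in> R" "q < g q" using gR pq up[of q] by auto
    ultimately obtain x where "x \<in> R \<inter> {q..}" "g x \<notin> R \<inter> {q..}"
      using irreducible_on_escape[OF irr, of "R \<inter> {q..}" q "g q" p q] pq by auto
    then show ?thesis using that gR by auto
  qed
  have "q < y" using y up[of q] pq by (cases "y = q") auto
  have "{p..y} \<noteq> {}" using y pq by auto
  then obtain t where t: "t \<in> {p..y}" "\<And>x. x \<in> {p..y} \<Longrightarrow> g x \<le> g t"
    using continuous_attains_sup[OF compact_Icc _ cont[OF sub[OF pq(1) y(1)]]] by blast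
  have "t \<in> R" using t(1) sub pq(1) y(1) by blast
  \<comment> \<open>A level that includes the maximum of \<open>g\<close> over \<open>{p..y}\<close>
    can only be exceeded beyond \<open>y\<close>.\<close>
  then have "max y (g t) \<in> R" using gR y by (simp add: max_def)
  moreover have "q \<le> max y (g t)" using y by (simp add: le_max_iff_disj)
  ultimately obtain x where x: "p < x" "x \<le> max y (g t)" "g x > max y (g t)"
    using escape by blast
  have "y < x" using t(2)[of x] x by force
  have "x \<in> R" using sub[OF pq(1) \<open>max y (g t) \<in> R\<close>] x(1,2) by auto
  \<comment> \<open>\<open>g\<close> is below the diagonal at \<open>y\<close> and above it at
    \<open>x\<close>. Up to the first fixed point \<open>d\<close> in between it stays below, while
    escape at level \<open>d\<close> gives \<open>w < d\<close> with \<open>g w > d\<close>: the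
    mirrored return situation.\<close>
  have "x \<le> g x" "g y < y" "y \<le> x" using x y \<open>y < x\<close> by auto
  then obtain d where d: "y < d" "d \<le> x" "d = g d" "\<And>w. y \<le> w \<Longrightarrow> w < d \<Longrightarrow> g w < w"
    using first_meeting[OF continuous_on_id cont[OF sub[OF y(1) \<open>x \<in> R\<close>]]] by blast
  have "d \<in> R" using sub[OF y(1) \<open>x \<in> R\<close>] d by auto
  then obtain w where w: "p < w" "w \<le> d" "g w > d" using escape[of d] d y by auto
  have "w \<in> R" using sub[OF pq(1) \<open>d \<in> R\<close>] w by auto
  have "w < d" using w d by (cases "w = d") auto
  show ?thesis
    by (rule horseshoe_return_left[OF irr \<open>d \<in> R\<close> d(3)[symmetric] d(1) _ \<open>w \<in> R\<close> \<open>w < d\<close>])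
      (use w d(4) in force)+
qed

lemma horseshoe_repelling_left:
  assumes irr: "irreducible_on g R" and pq: "p \<in> R" "q \<in> R" "g p = p" "q < p"
    and down: "\<And>x. q \<le> x \<Longrightarrow> x < p \<Longrightarrow> g x < x"
  shows "\<exists>a b d. horseshoe g R a b d"
proof (rule horseshoe_reflect, rule horseshoe_repelling[OF irreducible_on_reflect[OF irr], of "- p" "- q"])
  fix x assume "- p < x" "x \<le> - q"
  then show "x < - g (- x)" using down[of "- x"] by simp
qed (use pq in simp_all)

text \<open>The last fixed point before a point moved up repels to the right; the first one after a
  point moved down repels to the left. If \<open>c\<close> is fixed, irreducibility supplies a moved
  point between \<open>z\<close> and \<open>c\<close>.\<close>

lemma horseshoe_exists_right:
  assumes irr: "irreducible_on g R" and zc: "z \<in> R" "c \<in> R" "g z = z" "z < c" "c \<le> g c"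
  shows "\<exists>a b d. horseshoe g R a b d"
proof -
  have sub: "{x..y} \<subseteq> R" if "x \<in> R" "y \<in> R" for x y
    using irr that unfolding irreducible_on_def
    by (meson atLeastAtMost_iff is_interval_1 subsetI)
  have cont: "continuous_on S g" if "S \<subseteq> R" for S
    using irr that unfolding irreducible_on_def by (meson continuous_on_subset)
  have up: ?thesis if w: "w \<in> R" "z < w" "w < g w" for w
  proof -
    have "g z \<le> z" "z \<le> w" using w zc by auto
    then obtain p where p: "z \<le> p" "p < w" "g p = p" "\<And>x. p < x \<Longrightarrow> x \<le> w \<Longrightarrow> g x > x"
      using last_meeting[OF cont[OF sub[OF zc(1) w(1)]] continuous_on_id _ _ w(3)]
      by blast
    have "p \<in> R" using sub[OF zc(1) w(1)] p by auto
    then show ?thesis using horseshoe_repelling[OF irr _ w(1) p(3,2,4)] by blast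
  qed
  show ?thesis
  proof (cases "g c = c")
    case True
    \<comment> \<open>Stopping at the midpoint leaves a gap between \<open>?m\<close> and
      \<open>c\<close>, so \<open>{z..?m}\<close> is not invariant.\<close>
    let ?m = "(z + c) / 2"
    have "{z..c} \<subseteq> R" using sub zc by blast
    then obtain w where w: "w \<in> {z..?m}" "g w \<notin> {z..?m}"
      using irreducible_on_escape[OF irr, of "{z..?m}" z ?m ?m c] zc by (auto simp: subset_eq)
    have "w \<in> R" using w \<open>{z..c} \<subseteq> R\<close> zc by auto
    have "z < w" using w zc by (cases "w = z") auto
    have "w < c" using w(1) zc by auto
    show ?thesis
    proof (cases "w < g w")
      case True
      then show ?thesis using up \<open>w \<in> R\<close> \<open>z < w\<close> by blast
    next
      case False
      with w have "g w < w" by (cases "g w = w") auto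
      have "w \<le> c" using \<open>w < c\<close> by simp
      with \<open>g w < w\<close> obtain p where p: "w < p" "p \<le> c" "p = g p" "\<And>x. w \<le> x \<Longrightarrow> x < p \<Longrightarrow> g x < x"
        using first_meeting[OF continuous_on_id cont[OF sub[OF \<open>w \<in> R\<close> zc(2)]]] zc(5)
        by blast
      have "p \<in> R" using sub[OF \<open>w \<in> R\<close> zc(2)] p by auto
      then show ?thesis using horseshoe_repelling_left[OF irr _ \<open>w \<in> R\<close> p(3)[symmetric] p(1,4)] by blast
    qed
  qed (use up zc in force)
qed

lemma horseshoe_exists:
  assumes irr: "irreducible_on g R" and zc: "z \<in> R" "c \<in> R" "g z = z" "c \<noteq> z" "(g c - z) / (c - z) \<ge> 1"
  shows "\<exists>a b d. horseshoe g R a b d"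
proof (cases "z < c")
  case True
  then show ?thesis using horseshoe_exists_right[OF irr zc(1-3)] zc(5) by (auto simp: field_simps)
next
  case False
  with zc have "c < z" by simp
  then have "g c \<le> c" using zc(5) by (auto simp: field_simps)
  show ?thesis
  proof (rule horseshoe_reflect,
      rule horseshoe_exists_right[OF irreducible_on_reflect[OF irr], of "- z" "- c"])
  qed (use zc(1-3) \<open>c < z\<close> \<open>g c \<le> c\<close> in simp_all)
qed

section \<open>Turbulence and periodic points from horseshoes\<close>

lemma compact_interval_segment: "a \<noteq> b \<Longrightarrow> compact_interval (closed_segment a b)"
  unfolding compact_interval_def closed_segment_eq_real_ivl
  by (intro exI[of _ "min a b"] exI[of _ "max a b"]) (auto simp: min_def max_def)

lemma interval_segment: "is_interval I \<Longrightarrow> a \<in> I \<Longrightarrow> b \<in> I \<Longrightarrow> closed_segment a b \<subseteq> (I::real set)"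
  by (simp add: closed_segment_subset is_interval_convex)

lemma segment_cover_open:
  fixes f :: "real \<Rightarrow> real"
  assumes "continuous_on I f" "closed_segment a b \<subseteq> I" "y \<in> open_segment (f a) (f b)"
  obtains x where "x \<in> open_segment a b" "f x = y"
proof -
  obtain x where "x \<in> closed_segment a b" "f x = y"
    using segment_cover[OF assms(1,2)] assms(3) by (auto simp: open_segment_def)
  then show ?thesis using assms(3) that by (auto simp: open_segment_def)
qed

lemma segment_cover_square:
  fixes f :: "real \<Rightarrow> real"
  assumes "continuous_on I f" "closed_segment a b \<subseteq> I" "S \<subseteq> f ` closed_segment (f a) (f b)"
  shows "S \<subseteq> (f ^^ 2) ` closed_segment a b"
proof -
  have "f ` closed_segment (f a) (f b) \<subseteq> f ` f ` closed_segment a b"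
    by (intro image_mono segment_cover[OF assms(1,2)])
  then show ?thesis using assms(3) by (auto simp: numeral_2_eq_2 image_image)
qed

lemma turbulent_on_segments:
  assumes I: "is_interval I" "u \<in> I" "w \<in> I" and v: "v \<in> open_segment u w"
    and cov: "closed_segment u w \<subseteq> g ` closed_segment u v" "closed_segment u w \<subseteq> g ` closed_segment v w"
  shows "turbulent_on g I"
proof -
  have sub: "closed_segment u v \<union> closed_segment v w = closed_segment u w"
    and meet: "closed_segment u v \<inter> closed_segment v w \<subseteq> {v}"
    and ne: "u \<noteq> w" "u \<noteq> v" "v \<noteq> w"
    using v by (auto simp: closed_segment_eq_real_ivl open_segment_eq_real_ivl split: if_splits)
  show ?thesis
    unfolding turbulent_on_def
  proof (rule exI[of _ "closed_segment u w"], rule exI[of _ "closed_segment u v"],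
      rule exI[of _ "closed_segment v w"], intro conjI)
    show "\<exists>p. closed_segment u v \<inter> closed_segment v w \<subseteq> {p}" using meet by blast
    show "closed_segment u v \<subseteq> closed_segment u w" "closed_segment v w \<subseteq> closed_segment u w"
      "closed_segment u v \<union> closed_segment v w \<subseteq> g ` closed_segment u v \<inter> g ` closed_segment v w"
      using sub cov by auto
  qed (fact ne[THEN compact_interval_segment] interval_segment[OF I])+
qed

lemma doubly_turbulent_on_segments:
  assumes "is_interval I" "u \<in> I" "v \<in> I" "u' \<in> I" "v' \<in> I" "u \<noteq> v" "u' \<noteq> v'"
    and "closed_segment u v \<inter> closed_segment u' v' \<subseteq> {p}"
    and "turbulent_on g (closed_segment u v)" "turbulent_on g (closed_segment u' v')"
  shows "doubly_turbulent_on g I"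
  unfolding doubly_turbulent_on_def
  by (rule exI[of _ "closed_segment u v"], rule exI[of _ "closed_segment u' v'"],
      intro conjI exI[of _ p] compact_interval_segment interval_segment assms)

context
  fixes f :: "real \<Rightarrow> real" and I :: "real set"
  assumes I: "is_interval I" and self: "f ` I \<subseteq> I" and cont: "continuous_on I f"
begin

lemma cover:
  assumes "x \<in> I" "y \<in> I"
  shows "closed_segment (f x) (f y) \<subseteq> f ` closed_segment x y"
  using segment_cover[OF cont interval_segment[OF I assms]] .

lemma cover_square:
  assumes "x \<in> I" "y \<in> I" "S \<subseteq> f ` closed_segment (f x) (f y)"
  shows "S \<subseteq> (f ^^ 2) ` closed_segment x y"
  using segment_cover_square[OF cont interval_segment[OF I assms(1,2)] assms(3)] .

lemma horseshoe_segments: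
  assumes "horseshoe g I a b d"
  shows "a \<in> I" "b \<in> I" "d \<in> I" "closed_segment a b \<subseteq> closed_segment a d"
    "closed_segment b d \<subseteq> closed_segment a d" "closed_segment a b \<inter> closed_segment b d = {b}"
    "a \<noteq> b" "b \<noteq> d" "a \<noteq> d"
proof -
  have b: "b \<in> open_segment a d" and ad: "a \<in> I" "d \<in> I" using assms by (auto simp: horseshoe_def)
  then show "a \<in> I" "d \<in> I" by auto
  show "b \<in> I" using interval_segment[OF I ad] b by (auto simp: open_segment_def)
  show "closed_segment a b \<subseteq> closed_segment a d"
    "closed_segment b d \<subseteq> closed_segment a d" "closed_segment a b \<inter> closed_segment b d = {b}"
    "a \<noteq> b" "b \<noteq> d" "a \<noteq> d"
    using b by (auto simp: closed_segment_eq_real_ivl open_segment_eq_real_ivl split: if_splits)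
qed

lemma horseshoe_turbulent:
  assumes hs: "horseshoe f I a b d"
  shows "turbulent_on f I"
proof -
  note s = horseshoe_segments[OF hs]
  show ?thesis
    using hs cover[of a b] cover[of b d] s(1-3)
    by (intro turbulent_on_segments[OF I s(1,3), of b]) (auto simp: horseshoe_def closed_segment_commute)
qed

text \<open>A preimage of \<open>b\<close> cuts each half into two quarters. Each quarter is mapped
  by \<open>f\<close> over one of the halves, and each half over the full segment.\<close>

lemma horseshoe_doubly_turbulent:
  assumes hs: "horseshoe f I a b d"
  shows "doubly_turbulent_on (f ^^ 2) I"
proof -
  note s = horseshoe_segments[OF hs]
  have v: "f a = a" "f b = d" "f d = a" and b: "b \<in> open_segment a d" using hs by (auto simp: horseshoe_def)
  obtain t where t: "t \<in> open_segment a b" "f t = b"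
    using segment_cover_open[OF cont interval_segment[OF I s(1,2)], of b] v b by auto
  obtain r where r: "r \<in> open_segment b d" "f r = b"
    using segment_cover_open[OF cont interval_segment[OF I s(2,3)], of b] v b
    by (auto simp: open_segment_commute)
  have tr: "t \<in> I" "r \<in> I" using t r interval_segment[OF I] s(1-3) by (auto simp: open_segment_def)
  have "turbulent_on (f ^^ 2) (closed_segment a b)"
  proof (rule turbulent_on_segments[OF _ _ _ t(1)])
    show "closed_segment a b \<subseteq> (f ^^ 2) ` closed_segment a t"
      using cover_square[of a t] cover[of a b] s v t tr by auto
    show "closed_segment a b \<subseteq> (f ^^ 2) ` closed_segment t b"
      using cover_square[of t b] cover[of b d] s v t tr by (auto simp: closed_segment_commute)
  qed (auto simp: is_interval_closed_segment_1)
  moreover have "turbulent_on (f ^^ 2) (closed_segment b d)"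
  proof (rule turbulent_on_segments[OF _ _ _ r(1)])
    show "closed_segment b d \<subseteq> (f ^^ 2) ` closed_segment b r"
      using cover_square[of b r] cover[of b d] s v r tr by (auto simp: closed_segment_commute)
    show "closed_segment b d \<subseteq> (f ^^ 2) ` closed_segment r d"
      using cover_square[of r d] cover[of a b] s v r tr by (auto simp: closed_segment_commute)
  qed (auto simp: is_interval_closed_segment_1)
  ultimately show ?thesis
    using doubly_turbulent_on_segments[OF I s(1,2) s(2,3) s(7,8) equalityD1[OF s(6)]] by blast
qed

text \<open>The orbit of \<open>b\<close> goes to \<open>d\<close> and then stays at
  \<open>a\<close>. This excludes the one point that the two halves share.\<close>

lemma horseshoe_not_periodic:
  assumes hs: "horseshoe g I a b d" and "n > 0"
  shows "(g ^^ n) b \<noteq> b"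
proof -
  have v: "g a = a" "g b = d" "g d = a" using hs by (auto simp: horseshoe_def)
  have "(g ^^ Suc n) b = a \<or> (g ^^ Suc n) b = d" for n
  proof (induction n)
    case (Suc n)
    then show ?case using v by (metis comp_apply funpow.simps(2))
  qed (simp add: v)
  then show ?thesis using \<open>n > 0\<close> horseshoe_segments(7,8)[OF hs] by (metis Suc_pred)
qed

text \<open>The loop visits the half at \<open>a\<close> once and the half at \<open>d\<close> in
  the other \<open>m - 1\<close> steps. A point returning early would lie in both halves, hence be
  \<open>b\<close>.\<close>

lemma horseshoe_period_point:
  assumes hs: "horseshoe f I a b d" and "m \<ge> 1"
  shows "\<exists>x. period_point f I m x"
proof -
  note s = horseshoe_segments[OF hs]
  have v: "f a = a" "f b = d" "f d = a" using hs by (auto simp: horseshoe_def)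
  define p where "p i = (if i mod m = 0 then a else b)" for i
  define q where "q i = (if i mod m = 0 then b else d)" for i
  have "closed_segment (p i) (q i) \<subseteq> closed_segment a d" for i using s by (auto simp: p_def q_def)
  moreover have "closed_segment a d \<subseteq> f ` closed_segment (p i) (q i)" for i
    using cover[of a b] cover[of b d] s(1-3) v by (auto simp: p_def q_def closed_segment_commute)
  moreover have "closed_segment a d \<subseteq> I" using interval_segment[OF I] s by blast
  ultimately obtain x where x: "(f ^^ m) x = x" "\<And>i. i \<le> m \<Longrightarrow> (f ^^ i) x \<in> closed_segment (p i) (q i)"
    using covering_loop[where p = p and q = q and n = m, OF self cont]
    by (metis p_def q_def mod_0 mod_self subset_trans)
  have x0: "x \<in> closed_segment a b" using x(2)[of 0] by (simp add: p_def q_def)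
  have "(f ^^ i) x \<noteq> x" if "0 < i" "i < m" for i
  proof
    assume eq: "(f ^^ i) x = x"
    have "x \<in> closed_segment b d" using x(2)[of i] that eq by (simp add: p_def q_def)
    with x0 s(6) have "x = b" by auto
    with eq that horseshoe_not_periodic[OF hs] show False by blast
  qed
  moreover have "x \<in> I" using x0 interval_segment[OF I s(1,2)] by auto
  ultimately show ?thesis using x(1) \<open>m \<ge> 1\<close> by (auto simp: period_point_def)
qed

subsection \<open>Horseshoes of the second iterate across a fixed point\<close>

text \<open>Only the three marked points have to cross \<open>z\<close> under \<open>f\<close>. The
  inequalities are weak so that \<open>a = z\<close> is allowed.\<close>

definition crossing_horseshoe :: "real \<Rightarrow> real \<Rightarrow> real \<Rightarrow> real \<Rightarrow> bool" where
  "crossing_horseshoe z a b d \<longleftrightarrow> horseshoe (f ^^ 2) I a b d \<and> f z = z \<and>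
     (\<forall>x\<in>{a, b, d}. z \<le> x \<and> f x \<le> z)"

lemma crossing_horseshoeD:
  assumes "crossing_horseshoe z a b d"
  shows "horseshoe (f ^^ 2) I a b d" "f z = z" "f (f a) = a" "f (f b) = d" "f (f d) = a"
    "z \<le> a" "z \<le> b" "z \<le> d" "f a \<le> z" "f b \<le> z" "f d \<le> z"
  using assms by (auto simp: crossing_horseshoe_def horseshoe_def numeral_2_eq_2)

text \<open>The segment from \<open>a\<close> to \<open>d\<close> is one turbulent interval; its
  image under \<open>f\<close> contains another one left of \<open>z\<close>, so the two meet at
  most in \<open>z\<close>.\<close>

lemma crossing_horseshoe_doubly_turbulent:
  assumes ch: "crossing_horseshoe z a b d"
  shows "doubly_turbulent_on (f ^^ 2) I"
proof -
  note h = crossing_horseshoeD[OF ch]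
  note s = horseshoe_segments[OF h(1)]
  have b: "b \<in> open_segment a d" using h(1) by (auto simp: horseshoe_def)
  have fI: "f a \<in> I" "f b \<in> I" "f d \<in> I" using self s(1-3) by auto
  have ne: "f b \<noteq> f a" "f b \<noteq> f d" using h(3-5) s by auto
  have Kab: "closed_segment a d \<subseteq> f ` closed_segment (f a) (f b)"
    using cover[of "f a" "f b"] fI h(3-5) by simp
  have Kbd: "closed_segment a d \<subseteq> f ` closed_segment (f b) (f d)"
    using cover[of "f b" "f d"] fI h(3-5) by (simp add: closed_segment_commute)
  have hull: "closed_segment (f a) (f d) \<subseteq> f ` closed_segment a d" using cover s by auto
  have right: "turbulent_on (f ^^ 2) (closed_segment a d)"
    by (rule turbulent_on_segments[OF _ _ _ b])
      (use cover_square[OF _ _ Kab] cover_square[OF _ _ Kbd] s in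
        \<open>auto simp: is_interval_closed_segment_1\<close>)
  have left: "\<exists>u w. u \<noteq> w \<and> u \<in> I \<and> w \<in> I \<and> u \<le> z \<and> w \<le> z \<and> turbulent_on (f ^^ 2) (closed_segment u w)"
  proof (cases "f b \<in> open_segment (f a) (f d)")
    case True
    \<comment> \<open>Both pieces at \<open>f b\<close> are mapped by \<open>f\<close> over the
      segment from \<open>a\<close> to \<open>d\<close>, whose image covers both pieces
      again.\<close>
    have "closed_segment (f a) (f d) \<subseteq> (f ^^ 2) ` closed_segment (f a) (f b)"
      "closed_segment (f a) (f d) \<subseteq> (f ^^ 2) ` closed_segment (f b) (f d)"
      using cover_square[OF fI(1,2)] cover_square[OF fI(2,3)] hull h(3-5)
      by (auto simp: closed_segment_commute)
    then have "turbulent_on (f ^^ 2) (closed_segment (f a) (f d))"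
      by (intro turbulent_on_segments[OF _ _ _ True]) (auto simp: is_interval_closed_segment_1)
    then show ?thesis using fI h(9,11) True by (intro exI[of _ "f a"] exI[of _ "f d"]) auto
  next
    case False
    text \<open>Now \<^term>\<open>f a\<close> and \<^term>\<open>f d\<close> lie on the same side of \<^term>\<open>f b\<close>; both are mapped to
      \<^term>\<open>a\<close>, and the nearer one is the other endpoint of the interval sought.\<close>
    then obtain e where e: "e \<in> {f a, f d}" "closed_segment e (f b) \<subseteq> closed_segment (f a) (f b)"
      "closed_segment e (f b) \<subseteq> closed_segment (f b) (f d)"
    proof (cases "closed_segment (f a) (f b) \<subseteq> closed_segment (f b) (f d)")
      case True
      then show ?thesis using that[of "f a"] by auto
    next
      case nsub: False
      have "closed_segment (f d) (f b) \<subseteq> closed_segment (f a) (f b)"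
        using False nsub by (auto simp: closed_segment_eq_real_ivl open_segment_eq_real_ivl split: if_splits)
      then show ?thesis using that[of "f d"] by (auto simp: closed_segment_commute)
    qed
    have eI: "e \<in> I" "e \<le> z" "e \<noteq> f b" "f e = a" using e(1) fI h ne by auto
    \<comment> \<open>As \<open>t\<close> is a preimage of \<open>b\<close>, the pieces at
      \<open>t\<close> are mapped over the two halves, and by the choice of \<open>e\<close> each
      half is mapped over the segment from \<open>e\<close> to \<open>f b\<close>.\<close>
    obtain t where t: "t \<in> open_segment e (f b)" "f t = b"
      using segment_cover_open[OF cont interval_segment[OF I eI(1) fI(2)], of b] eI h(4) b by auto
    have tI: "t \<in> I" using t interval_segment[OF I eI(1) fI(2)] by (auto simp: open_segment_def)
    have "turbulent_on (f ^^ 2) (closed_segment e (f b))"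
    proof (rule turbulent_on_segments[OF _ _ _ t(1)])
      have "closed_segment e (f b) \<subseteq> f ` closed_segment a b" using cover[of a b] e(2) s by blast
      then show "closed_segment e (f b) \<subseteq> (f ^^ 2) ` closed_segment e t"
        using cover_square[OF eI(1) tI] t(2) eI(4) by simp
      have "closed_segment e (f b) \<subseteq> f ` closed_segment b d" using cover[of b d] e(3) s by blast
      then show "closed_segment e (f b) \<subseteq> (f ^^ 2) ` closed_segment t (f b)"
        using cover_square[OF tI fI(2)] t(2) h(4) by simp
    qed (auto simp: is_interval_closed_segment_1)
    then show ?thesis using eI fI(2) h(10) by blast
  qed
  then obtain u w where uw: "u \<noteq> w" "u \<in> I" "w \<in> I" "u \<le> z" "w \<le> z"
    "turbulent_on (f ^^ 2) (closed_segment u w)" by blast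
  have "closed_segment a d \<inter> closed_segment u w \<subseteq> {z}"
    using uw(4,5) h(6,8) by (auto simp: closed_segment_eq_real_ivl split: if_splits)
  then show ?thesis
    using doubly_turbulent_on_segments[OF I s(1,3) uw(2,3) s(9) uw(1) _ right uw(6)] by blast
qed

text \<open>The loop runs through the halves at even times and through the segments spanned by the
  images of their endpoints at odd times. An early return at an even time forces the point to be
  \<open>b\<close>; at an odd time the iterate is not right of \<open>z\<close>, but the point
  is.\<close>

lemma crossing_horseshoe_period_point:
  assumes ch: "crossing_horseshoe z a b d" and m: "m \<ge> 1" "even m"
  shows "\<exists>x. period_point f I m x"
proof -
  note h = crossing_horseshoeD[OF ch]
  note s = horseshoe_segments[OF h(1)]
  have "m \<ge> 2" using m by (cases "m = 1") auto
  \<comment> \<open>Times 0 and 1 belong together because two steps of \<open>f\<close> make one of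
    \<open>f ^^ 2\<close>: one double step starts in the half at \<open>d\<close>, all others in the
    half at \<open>a\<close>.\<close>
  define P where "P i = (if i mod m \<in> {0, 1} then b else a)" for i
  define Q where "Q i = (if i mod m \<in> {0, 1} then d else b)" for i
  define p where "p i = (if even i then P i else f (P i))" for i
  define q where "q i = (if even i then Q i else f (Q i))" for i
  have PQ: "P i \<in> I" "Q i \<in> I" for i using s by (auto simp: P_def Q_def)
  then have "p i \<in> I" "q i \<in> I" for i using self by (auto simp: p_def q_def)
  then have sub: "closed_segment (p i) (q i) \<subseteq> I" for i using interval_segment[OF I] by blast
  have cov: "closed_segment (p (Suc i)) (q (Suc i)) \<subseteq> f ` closed_segment (p i) (q i)" if "i < m" for i
  proof (cases "even i")
    case True
    then have "Suc i < m" using that m(2) by (metis Suc_lessI even_Suc)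
    with True have "P (Suc i) = P i" "Q (Suc i) = Q i" by (auto simp: P_def Q_def)
    with True show ?thesis using cover[OF PQ] by (simp add: p_def q_def)
  next
    case False
    then have "closed_segment (p (Suc i)) (q (Suc i)) \<subseteq> closed_segment a d"
      using s by (auto simp: p_def q_def P_def Q_def)
    also have "\<dots> = closed_segment (f (f (P i))) (f (f (Q i)))"
      using h by (auto simp: P_def Q_def closed_segment_commute)
    also have "\<dots> \<subseteq> f ` closed_segment (p i) (q i)"
      using False cover self PQ[of i] by (simp add: p_def q_def image_subset_iff)
    finally show ?thesis .
  qed
  have "p m = p 0" "q m = q 0" using m by (auto simp: p_def q_def P_def Q_def)
  then obtain x where x: "(f ^^ m) x = x" "\<And>i. i \<le> m \<Longrightarrow> (f ^^ i) x \<in> closed_segment (p i) (q i)"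
    using covering_loop[where p = p and q = q and n = m, OF self cont sub cov] by blast
  have x0: "x \<in> closed_segment b d" using x(2)[of 0] by (simp add: p_def q_def P_def Q_def)
  \<comment> \<open>\<open>f ^^ 2\<close> fixes \<open>z\<close> but moves \<open>b\<close> to
    \<open>d\<close> and \<open>d\<close> to \<open>a\<close>.\<close>
  have "b \<noteq> z" "d \<noteq> z" using h(2-5) s by auto
  then have "z < x" using x0 h(7,8) by (auto simp: closed_segment_eq_real_ivl split: if_splits)
  have "(f ^^ i) x \<noteq> x" if i: "0 < i" "i < m" for i
  proof
    assume eq: "(f ^^ i) x = x"
    show False
    proof (cases "even i")
      case True
      then have "x \<in> closed_segment a b"
        using x(2)[of i] i eq by (auto simp: p_def q_def P_def Q_def)
      with x0 s(6) have "x = b" by auto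
      with eq True i horseshoe_not_periodic[OF h(1), of "i div 2"] show False
        by (auto simp: funpow_mult elim!: evenE)
    next
      case False
      then have "x \<in> closed_segment (f (P i)) (f (Q i))"
        using x(2)[of i] i eq by (auto simp: p_def q_def)
      moreover have "f (P i) \<le> z" "f (Q i) \<le> z" using h by (auto simp: P_def Q_def)
      ultimately show False using \<open>z < x\<close> by (auto simp: closed_segment_eq_real_ivl split: if_splits)
    qed
  qed
  moreover have "x \<in> I" using x0 interval_segment[OF I s(2,3)] by auto
  ultimately show ?thesis using x(1) m by (auto simp: period_point_def)
qed

section \<open>Transitivity and the cut-off return map\<close>

text \<open>Iterates of \<open>{u<..<v}\<close> never leave \<open>K\<close>, yet one of them meets
  \<open>{r<..<s}\<close>. \<open>K\<close> may be any set, since it will be a union of pieces on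
  both sides of \<open>z\<close>.\<close>

lemma transitive_invariant_dense:
  assumes "transitive_on f I" "K \<subseteq> I" "f ` K \<subseteq> K" "u < v" "{u<..<v} \<subseteq> K" "r < s" "{r<..<s} \<subseteq> I"
  shows "{r<..<s} \<inter> K \<noteq> {}"
proof -
  have op: "openin (top_of_set I) {x<..<y}" if "{x<..<y} \<subseteq> I" for x y
    using that by (metis inf.absorb_iff2 open_greaterThanLessThan openin_open)
  have "{u<..<v} \<noteq> {}" "{r<..<s} \<noteq> {}" using assms by auto
  then obtain k where "(f ^^ k) ` {u<..<v} \<inter> {r<..<s} \<noteq> {}"
    using assms op unfolding transitive_on_def by (metis order_trans)
  moreover have "(f ^^ k) ` {u<..<v} \<subseteq> K" using funpow_self_map[OF assms(3)] assms(5) by blast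
  ultimately show ?thesis by blast
qed

lemma transitive_irreducible:
  assumes "transitive_on f I"
  shows "irreducible_on f I"
  unfolding irreducible_on_def
proof (intro conjI allI impI)
  fix K u v r s
  assume "is_interval K \<and> K \<subseteq> I \<and> f ` K \<subseteq> K \<and> u < v \<and> {u<..<v} \<subseteq> K \<and>
    r < s \<and> {r<..<s} \<subseteq> I"
  then show "{r<..<s} \<inter> K \<noteq> {}"
    using transitive_invariant_dense[OF assms, of K u v r s] by simp
qed (fact I self cont)+

text \<open>Cutting \<^term>\<open>f\<close> off at \<^term>\<open>z\<close> twice keeps only those orbit pieces of length two that
  cross from the right of \<^term>\<open>z\<close> to the left and back.\<close>

definition return_map :: "real \<Rightarrow> real \<Rightarrow> real" where
  "return_map z x = max z (f (min z (f x)))"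

lemma return_map_crossing:
  assumes "f z = z" "z < return_map z x"
  shows "f x < z" "f (f x) = return_map z x"
  using assms by (auto simp: return_map_def min_def max_def split: if_splits)

context
  fixes z :: real
  assumes tr: "transitive_on f I" and z: "z \<in> I" "f z = z"
    and left: "\<And>x. x \<in> I \<Longrightarrow> x < z \<Longrightarrow> x < f x"
    and right: "\<And>x. x \<in> I \<Longrightarrow> z < x \<Longrightarrow> f x < x"
begin

lemma return_map_z: "return_map z z = z"
  by (simp add: return_map_def z)

text \<open>An invariant interval \<open>K\<close> of the cut-off map is enlarged by points not to
  the right of \<open>z\<close> to a set invariant under \<open>f\<close>. That set is dense in
  \<open>I\<close>, so right of \<open>z\<close> the density comes from \<open>K\<close>
  alone.\<close>

lemma irreducible_return_map: "irreducible_on (return_map z) (I \<inter> {z..})"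
  unfolding irreducible_on_def
proof (intro conjI allI impI)
  let ?g = "return_map z"
  show "is_interval (I \<inter> {z..})" using I unfolding is_interval_1 by fastforce
  have min: "min z (f x) \<in> I" if "x \<in> I" for x using self z that by (auto simp: min_def)
  have "continuous_on I (\<lambda>x. f (min z (f x)))"
    using min by (intro continuous_on_compose2[OF cont] continuous_intros cont) auto
  then have "continuous_on I ?g" unfolding return_map_def by (intro continuous_intros)
  then show "continuous_on (I \<inter> {z..}) ?g" by (rule continuous_on_subset) auto
  show "?g ` (I \<inter> {z..}) \<subseteq> I \<inter> {z..}"
    using min self z by (auto simp: return_map_def max_def)
next
  fix K u v r s
  assume "is_interval K \<and> K \<subseteq> I \<inter> {z..} \<and> return_map z ` K \<subseteq> K \<and> u < v \<and> {u<..<v} \<subseteq> K \<and>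
    r < s \<and> {r<..<s} \<subseteq> I \<inter> {z..}"
  then have K: "is_interval K" "K \<subseteq> I" "\<And>x. x \<in> K \<Longrightarrow> z \<le> x" "\<And>x. x \<in> K \<Longrightarrow> return_map z x \<in> K"
    and uv: "u < v" "{u<..<v} \<subseteq> K" and rs: "r < s" "{r<..<s} \<subseteq> I" "\<And>x. x \<in> {r<..<s} \<Longrightarrow> z \<le> x"
    by auto
  show "{r<..<s} \<inter> K \<noteq> {}"
  proof (cases "z \<in> K")
    case False
    \<comment> \<open>With \<open>z\<close> outside \<open>K\<close>, the cut-off value is never
      \<open>z\<close>, so each point of \<open>K\<close> truly crosses and comes back to
      \<open>K\<close>.\<close>
    have "f x < z" "f (f x) \<in> K" if "x \<in> K" for x
    proof -
      have "z < return_map z x" using K(3,4)[of "return_map z x"] K(4)[OF that] False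
        by (metis order_le_less)
      from return_map_crossing[OF z(2) this] show "f x < z" "f (f x) \<in> K" using K(4)[OF that] by auto
    qed
    note ff = this
    have "{r<..<s} \<inter> (K \<union> f ` K) \<noteq> {}"
      by (rule transitive_invariant_dense[OF tr _ _ uv(1) _ rs(1,2)]) (use K(2) self uv ff in auto)
    then show ?thesis using ff rs(3) by force
  next
    case True
    \<comment> \<open>Points of \<open>L\<close> left of \<open>z\<close> move to the right. Those
      not jumping over \<open>z\<close> land between their position and \<open>z\<close>, hence in
      the image of \<open>K\<close> again; those jumping over land on a value of the cut-off map,
      hence in \<open>K\<close>.\<close>
    define L where "L = f ` K \<inter> {..z}"
    have "f ` (K \<union> L) \<subseteq> K \<union> L"
    proof (rule image_subsetI)
      fix x assume "x \<in> K \<union> L"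
      then consider "x \<in> K" "z < x" | "x = z" | "x \<in> L" "x < z" using K(3) unfolding L_def by fastforce
      then show "f x \<in> K \<union> L"
      proof cases
        case 1
        then have "f x < x" using right K(2) by auto
        then have "f x \<in> K" if "z < f x"
          using K(1) True 1(1) that unfolding is_interval_1 by (meson less_imp_le)
        then show ?thesis using 1 unfolding L_def by fastforce
      next
        case 2
        then show ?thesis using z True by simp
      next
        case 3
        then obtain t where t: "t \<in> K" "x = f t" unfolding L_def by auto
        have "x \<in> I" using t K(2) self by auto
        then have "x < f x" using left 3 by auto
        show ?thesis
        proof (cases "f x \<le> z")
          case fx: True
          then have "f x \<in> closed_segment (f t) (f z)"
            using \<open>x < f x\<close> t 3 z by (simp add: closed_segment_eq_real_ivl)
          then have "f x \<in> f ` closed_segment t z" using cover[of t z] t K(2) z by auto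
          moreover have "closed_segment t z \<subseteq> K" using interval_segment[OF K(1) t(1) True] .
          ultimately show ?thesis using fx unfolding L_def by auto
        next
          case False
          then have "return_map z t = f x" using t 3 by (simp add: return_map_def)
          then show ?thesis using K(4)[OF t(1)] by simp
        qed
      qed
    qed
    then have "{r<..<s} \<inter> (K \<union> L) \<noteq> {}"
      by (rule transitive_invariant_dense[OF tr _ _ uv(1) _ rs(1,2), rotated])
        (use K(2) self uv in \<open>auto simp: L_def\<close>)
    then obtain w where w: "w \<in> {r<..<s}" "w \<in> K \<union> L" by blast
    with rs(3) True have "w \<in> K" unfolding L_def by fastforce
    with w show ?thesis by auto
  qed
qed

text \<open>The irreducible cut-off map fixes \<open>z\<close> and moves some \<open>c\<close> up,
  so it has a horseshoe. Its values above \<open>z\<close> are true values of \<open>f ^^ 2\<close>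
  along a crossing; so the case \<open>a > z\<close> transfers directly, and \<open>a = z\<close>
  needs new points in place of \<open>d\<close> and \<open>b\<close>.\<close>

lemma crossing_horseshoe_exists:
  assumes y: "y \<in> I" "z < y"
  shows "\<exists>a b d. crossing_horseshoe z a b d"
proof -
  let ?g = "return_map z" and ?R = "I \<inter> {z..}"
  note irr = irreducible_return_map
  have gR: "?g x \<in> ?R" if "x \<in> ?R" for x using irr that unfolding irreducible_on_def by blast
  have ivl: "{u..v} \<subseteq> I" if "u \<in> I" "v \<in> I" for u v
    using I that unfolding is_interval_1 by (meson atLeastAtMost_iff subsetI)
  let ?m = "(z + y) / 2"
  have "{z..y} \<subseteq> I" using ivl z y by blast
  then obtain c where c: "c \<in> {z..?m}" "?g c \<notin> {z..?m}"
    using irreducible_on_escape[OF irr, of "{z..?m}" z ?m ?m y] y z by (auto simp: subset_eq)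
  have "c \<in> ?R" using c \<open>{z..y} \<subseteq> I\<close> y by auto
  have "z < c" using c return_map_z y by (cases "c = z") auto
  have "c \<le> ?g c" using gR[OF \<open>c \<in> ?R\<close>] c by auto
  then obtain a b d where hs: "horseshoe ?g ?R a b d"
    using horseshoe_exists_right[OF irr _ \<open>c \<in> ?R\<close> return_map_z \<open>z < c\<close>] z by auto
  then have v: "?g a = a" "?g b = d" "?g d = a" and b: "b \<in> open_segment a d"
    and ad: "a \<in> I" "d \<in> I" "z \<le> a" "z \<le> d" by (auto simp: horseshoe_def)
  note cross = return_map_crossing[OF z(2)]
  have chI: "crossing_horseshoe z a' b' d'"
    if "a' \<in> I" "d' \<in> I" "b' \<in> open_segment a' d'" "z \<le> a'" "z \<le> d'"
      "f (f a') = a'" "f (f b') = d'" "f (f d') = a'" "f a' \<le> z" "f b' \<le> z" "f d' \<le> z" for a' b' d'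
    using that z unfolding crossing_horseshoe_def horseshoe_def
    by (auto simp: numeral_2_eq_2 open_segment_eq_real_ivl split: if_splits)
  show ?thesis
  proof (cases "z < a")
    case True
    have "z < d" using ad v(3) return_map_z True by (cases "d = z") auto
    with True v cross[of a] cross[of b] cross[of d] ad b show ?thesis
      using chI[of a d b] by auto
  next
    case False
    with ad have [simp]: "a = z" by simp
    have zbd: "z < b" "b < d" using b ad by (auto simp: open_segment_eq_real_ivl split: if_splits)
    have fb: "f b < z" "f (f b) = d" using cross[of b] v zbd by auto
    have sub: "{z..d} \<subseteq> I" using ivl z ad by blast
    have cg: "continuous_on S ?g" if "S \<subseteq> {z..d}" for S
      using irr sub that unfolding irreducible_on_def by (elim conjE continuous_on_subset) auto
    have cf: "continuous_on S f" if "S \<subseteq> {z..d}" for S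
      using cont sub that by (meson continuous_on_subset order_trans)
    have cff: "continuous_on S (\<lambda>x. f (f x))" if "S \<subseteq> {z..d}" for S
      using continuous_on_funpow[OF self cont, of 2] sub that
      by (auto simp: numeral_2_eq_2 o_def intro: continuous_on_subset)
    text \<open>The cut-off may only pretend that \<^term>\<open>d\<close> is mapped to \<^term>\<open>z\<close>, but the first point
      to the right of \<^term>\<open>b\<close> with this property really is.\<close>
    have "continuous_on {b..d} ?g" "z < ?g b" "?g d \<le> z" "b \<le> d" using cg zbd v by auto
    then obtain e where e: "b < e" "e \<le> d" "?g e = z" "\<And>x. b \<le> x \<Longrightarrow> x < e \<Longrightarrow> z < ?g x"
      using first_meeting[of b d ?g "\<lambda>_. z", OF _ continuous_on_const] by blast
    \<comment> \<open>Otherwise \<open>f\<close> would take the value \<open>z\<close> between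
      \<open>b\<close> and \<open>e\<close>, where a cut-off value above \<open>z\<close> forces
      \<open>f\<close> to be below \<open>z\<close>.\<close>
    have fe: "f e \<le> z"
    proof (rule ccontr)
      assume "\<not> f e \<le> z"
      then obtain x where x: "b \<le> x" "x \<le> e" "f x = z"
        using IVT'[of f b z e] fb e cf[of "{b..e}"] zbd by auto
      then show False using cross(1)[of x] e(4)[of x] \<open>\<not> f e \<le> z\<close> by (cases "x = e") auto
    qed
    have "f (f e) \<le> z" using e(3) fe by (simp add: return_map_def)
    \<comment> \<open>Otherwise \<open>f ^^ 2\<close> would take the value \<open>z\<close> before
      \<open>e\<close>, where it agrees with the cut-off map and exceeds \<open>z\<close>.\<close>
    moreover have "\<not> f (f e) < z"
    proof
      assume "f (f e) < z"
      then obtain x where x: "b \<le> x" "x \<le> e" "f (f x) = z"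
        using IVT2'[of "\<lambda>x. f (f x)" e z b] fb e cff[of "{b..e}"] zbd by auto
      then show False using cross(2)[of x] e(4)[of x] \<open>f (f e) < z\<close> by (cases "x = e") auto
    qed
    ultimately have ffe: "f (f e) = z" by simp
    \<comment> \<open>As \<open>e\<close> replaces \<open>d\<close>, a preimage of \<open>e\<close>
      must replace \<open>b\<close>; the cut-off map goes from \<open>z\<close> at \<open>z\<close>
      to \<open>d\<close> at \<open>b\<close> and so passes \<open>e\<close>.\<close>
    obtain x where x: "z \<le> x" "x \<le> b" "?g x = e"
      using IVT'[of ?g z e b] e zbd v return_map_z cg[of "{z..b}"] by auto
    have "x \<noteq> z" using x(3) return_map_z e zbd by auto
    moreover have "f x < z" "f (f x) = e" using cross[of x] x e zbd by auto
    ultimately have "crossing_horseshoe z z x e"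
      using z ffe fe e x zbd sub by (intro chI) (auto simp: open_segment_eq_real_ivl)
    then show ?thesis by blast
  qed
qed

end

end

section \<open>Fixed points and the alternative between (A) and (B)\<close>

text \<open>Neither half of \<open>R\<close> about a midpoint is invariant, so one point is moved
  left and another right. This covers open and unbounded intervals as well.\<close>

lemma irreducible_fixed_point:
  assumes irr: "irreducible_on g R" and xy: "x \<in> R" "y \<in> R" "x < y"
  shows "\<exists>z\<in>R. g z = z"
proof (rule ccontr)
  assume no: "\<not> (\<exists>z\<in>R. g z = z)"
  have R: "is_interval R" "continuous_on R g" and gR: "\<And>w. w \<in> R \<Longrightarrow> g w \<in> R"
    using irr unfolding irreducible_on_def by blast+
  let ?m = "(x + y) / 2"
  have m: "?m \<in> R" using mem_is_interval_1_I[OF R(1) xy(1,2)] xy(3) by simp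
  have half: "is_interval (R \<inter> {?m..})" "is_interval (R \<inter> {..?m})"
    using R(1) by (simp_all add: is_interval_Int is_interval_ci is_interval_ic)
  obtain v where v: "v \<in> R" "g v < v"
  proof -
    obtain v where "v \<in> R \<inter> {?m..}" "g v \<notin> R \<inter> {?m..}"
      using irreducible_on_escape[OF irr half(1), of ?m y x ?m] xy m by auto
    then show ?thesis using gR[of v] that by force
  qed
  obtain w where w: "w \<in> R" "w < g w"
  proof -
    obtain w where "w \<in> R \<inter> {..?m}" "g w \<notin> R \<inter> {..?m}"
      using irreducible_on_escape[OF irr half(2), of x ?m ?m y] xy m by auto
    then show ?thesis using gR[of w] that by force
  qed
  have sub: "closed_segment v w \<subseteq> R" using interval_segment[OF R(1) v(1) w(1)] .
  have "continuous_on (closed_segment v w) (\<lambda>x. g x - x)"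
    by (intro continuous_intros continuous_on_subset[OF R(2) sub])
  from IVT'_closed_segment_real[OF _ this, of 0] v w
  obtain u where "u \<in> closed_segment v w" "g u = u" by (auto simp: closed_segment_eq_real_ivl)
  with sub no show False by auto
qed

lemma nondegenerate_interval_imp:
  assumes "nondegenerate_interval I"
  shows "is_interval I" "\<exists>x\<in>I. \<exists>y\<in>I. x < y"
proof -
  obtain a b where ab: "a < b"
    "I = {a<..<b} \<or> I = {a<..b} \<or> I = {a..<b} \<or> I = {a..b} \<or>
         I = {..<b} \<or> I = {..b} \<or> I = {a<..} \<or> I = {a..} \<or> I = UNIV"
    using assms unfolding nondegenerate_interval_def by blast
  then show "is_interval I" by (elim disjE) (auto simp: is_interval_1)
  obtain c where c: "a < c" "c < b" using dense[OF ab(1)] by blast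
  obtain d where d: "c < d" "d < b" using dense[OF c(2)] by blast
  have "c \<in> I" "d \<in> I" using ab(2) c d by (elim disjE; simp)+
  with d show "\<exists>x\<in>I. \<exists>y\<in>I. x < y" by blast
qed

lemma not_condition_A:
  assumes "\<not> condition_A f I" "z \<in> I" "f z = z" "x \<in> I"
  shows "x < z \<Longrightarrow> x < f x" "z < x \<Longrightarrow> f x < x"
proof -
  have "(f x - z) / (x - z) < 1" if "x \<noteq> z"
    using assms that unfolding condition_A_def by (meson not_le)
  then show "x < z \<Longrightarrow> x < f x" "z < x \<Longrightarrow> f x < x" by (auto simp: field_simps split: if_splits)
qed

text \<open>Without (A), every other point is moved strictly in the direction of the fixed point
  \<open>z\<close>, which gives uniqueness and the sign in (B). Irreducibility keeps
  \<open>z\<close> off the ends of \<open>I\<close>.\<close>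

lemma condition_A_or_B:
  assumes irr: "irreducible_on f I" and xy: "x \<in> I" "y \<in> I" "x < y" and nA: "\<not> condition_A f I"
  shows "condition_B f I"
proof -
  have I: "is_interval I" and self: "\<And>x. x \<in> I \<Longrightarrow> f x \<in> I"
    using irr unfolding irreducible_on_def by blast+
  obtain z where z: "z \<in> I" "f z = z" using irreducible_fixed_point[OF irr xy] by blast
  note sides = not_condition_A[OF nA z]
  have ivl: "{u..v} \<subseteq> I" if "u \<in> I" "v \<in> I" for u v
    using I that unfolding is_interval_1 by (meson atLeastAtMost_iff subsetI)
  \<comment> \<open>If \<open>z\<close> were the left end of \<open>I\<close>, then
    \<open>z \<le> f w \<le> w\<close> throughout, and \<open>{z..?m}\<close> would be
    invariant.\<close>
  obtain l where l: "l \<in> I" "l < z"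
  proof (rule ccontr)
    assume "\<not> thesis"
    with that have min: "\<And>w. w \<in> I \<Longrightarrow> z \<le> w" by force
    then have "z < y" using xy by force
    let ?m = "(z + y) / 2"
    have sub: "{z..y} \<subseteq> I" using ivl z xy by blast
    then obtain w where w: "w \<in> {z..?m}" "f w \<notin> {z..?m}"
      using irreducible_on_escape[OF irr, of "{z..?m}" z ?m ?m y] \<open>z < y\<close> z xy by (auto simp: subset_eq)
    have "w \<in> I" using w sub \<open>z < y\<close> by auto
    then have "z \<le> f w" "f w \<le> w" using min self sides(2)[of w] z min[of w]
      by (auto simp: le_less[of _ w])
    with w show False by auto
  qed
  obtain r where r: "r \<in> I" "z < r"
  proof (rule ccontr)
    assume "\<not> thesis"
    with that have max: "\<And>w. w \<in> I \<Longrightarrow> w \<le> z" by force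
    then have "x < z" using xy by force
    let ?m = "(x + z) / 2"
    have sub: "{x..z} \<subseteq> I" using ivl z xy by blast
    then obtain w where w: "w \<in> {?m..z}" "f w \<notin> {?m..z}"
      using irreducible_on_escape[OF irr, of "{?m..z}" ?m z x ?m] \<open>x < z\<close> z xy by (auto simp: subset_eq)
    have "w \<in> I" using w sub \<open>x < z\<close> by auto
    then have "f w \<le> z" "w \<le> f w" using max self sides(1)[of w] z max[of w]
      by (auto simp: le_less[of w])
    with w show False by auto
  qed
  have "{l<..<r} \<subseteq> I" using ivl[OF l(1) r(1)] by auto
  then have "z \<in> interior I" using l r by (intro interiorI[of "{l<..<r}"]) auto
  moreover have "{x \<in> I. f x = x} = {z}"
    using z sides by (auto simp: neq_iff) (metis less_irrefl linorder_neqE_linordered_idom)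
  moreover have "(f x - x) / (z - x) > 0" if "x \<in> I" "x \<noteq> z" for x
    using sides[OF that(1)] that(2) by (cases "x < z") (auto simp: divide_simps)
  ultimately show ?thesis unfolding condition_B_def by blast
qed

lemma condition_B_sides:
  assumes "condition_B f I"
  obtains z where "{x \<in> I. f x = x} = {z}" "z \<in> interior I"
    "\<And>x. x \<in> I \<Longrightarrow> x < z \<Longrightarrow> x < f x" "\<And>x. x \<in> I \<Longrightarrow> z < x \<Longrightarrow> f x < x"
proof -
  obtain z where z: "{x \<in> I. f x = x} = {z}" "z \<in> interior I"
    "\<And>x. x \<in> I \<Longrightarrow> x \<noteq> z \<Longrightarrow> (f x - x) / (z - x) > 0"
    using assms unfolding condition_B_def by blast
  have "x < f x" if "x \<in> I" "x < z" for x
    using z(3)[of x] that by (auto simp: zero_less_divide_iff)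
  moreover have "f x < x" if "x \<in> I" "z < x" for x
    using z(3)[of x] that by (auto simp: zero_less_divide_iff)
  ultimately show ?thesis using that z(1,2) by blast
qed

text \<open>The fixed point in (A) must be the unique one of (B), in whose direction
  \<open>c\<close> moves strictly, so the quotient stays below 1.\<close>

lemma conditions_exclusive: "condition_B f I \<Longrightarrow> \<not> condition_A f I"
proof
  assume "condition_B f I" "condition_A f I"
  obtain z where z: "{x \<in> I. f x = x} = {z}" "z \<in> interior I"
    "\<And>x. x \<in> I \<Longrightarrow> x < z \<Longrightarrow> x < f x" "\<And>x. x \<in> I \<Longrightarrow> z < x \<Longrightarrow> f x < x"
    using condition_B_sides[OF \<open>condition_B f I\<close>] by blast
  obtain z' c where c: "z' \<in> I" "f z' = z'" "c \<in> I" "c \<noteq> z'" "(f c - z') / (c - z') \<ge> 1"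
    using \<open>condition_A f I\<close> unfolding condition_A_def by blast
  have "z' = z" using z(1) c(1,2) by blast
  with c z(3,4)[of c] show False by (cases "c < z") (auto simp: field_simps)
qed

theorem theorem1:
  fixes I :: "real set" and f :: "real \<Rightarrow> real"
  assumes "nondegenerate_interval I"
    and "f ` I \<subseteq> I"
    and "continuous_on I f"
    and "transitive_on f I"
  shows "((condition_A f I \<or> condition_B f I) \<and> \<not> (condition_A f I \<and> condition_B f I)) \<and>
    (condition_A f I \<longrightarrow>
       turbulent_on f I \<and> doubly_turbulent_on (f ^^ 2) I \<and>
       (\<forall>m\<ge>1. \<exists>x. period_point f I m x)) \<and>
    (condition_B f I \<longrightarrow>
       doubly_turbulent_on (f ^^ 2) I \<and>
       (\<forall>m\<ge>1. even m \<longrightarrow> (\<exists>x. period_point f I m x))) \<and>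
    ((\<forall>m\<ge>1. even m \<longrightarrow> (\<exists>x. period_point f I m x)) \<and>
       doubly_turbulent_on (f ^^ 2) I)"
proof -
  have I: "is_interval I" and ne: "\<exists>x\<in>I. \<exists>y\<in>I. x < y"
    using nondegenerate_interval_imp[OF assms(1)] by auto
  note irr = transitive_irreducible[OF I assms(2-4)]
  have A: "turbulent_on f I \<and> doubly_turbulent_on (f ^^ 2) I \<and> (\<forall>m\<ge>1. \<exists>x. period_point f I m x)"
    if A: "condition_A f I"
  proof -
    obtain a b d where "horseshoe f I a b d"
      using horseshoe_exists[OF irr] A unfolding condition_A_def by blast
    then show ?thesis
      using horseshoe_turbulent[OF I assms(2,3)] horseshoe_doubly_turbulent[OF I assms(2,3)]
        horseshoe_period_point[OF I assms(2,3)] by blast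
  qed
  have B: "doubly_turbulent_on (f ^^ 2) I \<and> (\<forall>m\<ge>1. even m \<longrightarrow> (\<exists>x. period_point f I m x))"
    if B: "condition_B f I"
  proof -
    obtain z where z: "{x \<in> I. f x = x} = {z}" "z \<in> interior I"
      "\<And>x. x \<in> I \<Longrightarrow> x < z \<Longrightarrow> x < f x" "\<And>x. x \<in> I \<Longrightarrow> z < x \<Longrightarrow> f x < x"
      using condition_B_sides[OF B] by blast
    \<comment> \<open>Since \<open>z\<close> is interior, \<open>I\<close> has a point to its right,
      as the crossing horseshoe requires.\<close>
    obtain e where e: "e > 0" "ball z e \<subseteq> I" using z(2) mem_interior by blast
    then have "z + e / 2 \<in> I" "z < z + e / 2" by (auto simp: dist_real_def)
    moreover have "z \<in> I" "f z = z" using z(1) by blast+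
    ultimately obtain a b d where "crossing_horseshoe f I z a b d"
      using crossing_horseshoe_exists[OF I assms(2-4) _ _ z(3,4)] by blast
    then show ?thesis
      using crossing_horseshoe_doubly_turbulent[OF I assms(2,3)]
        crossing_horseshoe_period_point[OF I assms(2,3)] by blast
  qed
  show ?thesis using A B condition_A_or_B[OF irr] conditions_exclusive ne by blast
qed

end
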